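(* There is a universal constant $C_0>0$ such that the following holds. Let $n\ge1$, let $\mathcal D$ be a self-adjoint superoperator on $n$-qubit operators that is diagonal in the Pauli basis, and let $\epsilon\in(0,1)$, $\delta\in(0,1/2]$. Then there is an algorithm which, for every Hermitian operator $O$ on $n$ qubits with $\mathrm{tr}(O^2)=2^n$ and every $n$-qubit unitary $U$, with $O(t)=U^\dagger OU$, estimates $\langle\mathcal D\rangle_{O(t)}=\mathrm{tr}\left(O(t)^\dagger\,\mathcal D(O(t))\right)/2^n$ to additive error $\epsilon$ with success probability at least $1-\delta$, using at most $C_0\|\mathcal D\|^2\log(1/\delta)/\epsilon^2$ samples of $|O(t)\rangle\rangle_{\mathcal P}$, measured in the computational basis.
   Context: $\mathcal P=\{I,X,Y,Z\}^{\otimes n}=\{P_1,\dots,P_{4^n}\}$. A superoperator is a linear map on the space of operators on $(\mathbb C^2)^{\otimes n}$; it is self-adjoint if it is so with respect to the inner product $\mathrm{tr}(A^\dagger B)$; it is diagonal in the Pauli basis if it has the form $\mathcal D(\cdot)=\sum_kf_kP_k(\cdot)P_k$ with scalars $f_k$. $\|\mathcal D\|$ is the operator (spectral) norm of $\mathcal D$ induced by the Hilbert-Schmidt norm $\sqrt{\mathrm{tr}(A^\dagger A)}$. For an operator $X\ne0$ put $c_k=\mathrm{tr}(P_kX)/2^n$; labelling the computational basis of the $2n$-qubit space by $k\in\{1,\dots,4^n\}$, the Pauli-basis vectorization is the unit vector $|X\rangle\rangle_{\mathcal P}=\sum_k\frac{c_k}{\sqrt{\sum_i|c_i|^2}}|k\rangle$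 (possible fixed phases in front of the $|k\rangle$ are irrelevant here). Each sample is an independent copy of the state; a computational basis measurement returns $k$ with probability equal to the squared modulus of the $k$-th amplitude. An "algorithm" is a classical post-processing of the measurement outcomes which may depend on $n,\mathcal D,\epsilon,\delta$ but has no access to $O,U$ other than through the outcomes. *)

theory Defs
  imports
    "HOL-Probability.Probability"
    "Jordan_Normal_Form.Schur_Decomposition"
begin

(* $ is reserved for Jordan_Normal_Form vectors *)
unbundle no vec_syntax

type_synonym superop = "complex mat \<Rightarrow> complex mat"

abbreviation operators :: "nat \<Rightarrow> complex mat set" where
  "operators n \<equiv> carrier_mat (2 ^ n) (2 ^ n)"

definition mat_trace :: "complex mat \<Rightarrow> complex" where
  "mat_trace A = (\<Sum>i<dim_row A. A $$ (i, i))"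

definition hermitian_mat :: "complex mat \<Rightarrow> bool" where
  "hermitian_mat A \<longleftrightarrow> mat_adjoint A = A"

definition unitary_mat :: "nat \<Rightarrow> complex mat \<Rightarrow> bool" where
  "unitary_mat N U \<longleftrightarrow>
     U \<in> carrier_mat N N \<and> mat_adjoint U * U = 1\<^sub>m N \<and> U * mat_adjoint U = 1\<^sub>m N"

definition kron :: "complex mat \<Rightarrow> complex mat \<Rightarrow> complex mat" where
  "kron A B = mat (dim_row A * dim_row B) (dim_col A * dim_col B)
     (\<lambda>(i, j). A $$ (i div dim_row B, j div dim_col B) * B $$ (i mod dim_row B, j mod dim_col B))"

(* The cases 0, 1, 2, 3 are I, X, Y, Z; only arguments below 4 are used. *)
definition pauli1 :: "nat \<Rightarrow> complex mat" where
  "pauli1 a = mat_of_rows_list 2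
     (if a = 0 then [[1, 0], [0, 1]]
      else if a = 1 then [[0, 1], [1, 0]]
      else if a = 2 then [[0, - \<i>], [\<i>, 0]]
      else [[1, 0], [0, - 1]])"

(* Pauli strings are indexed by k < 4 ^ n (zero-based): the n base-4 digits of k are the
   n tensor factors, the least significant digit being the last factor. *)
fun pauli :: "nat \<Rightarrow> nat \<Rightarrow> complex mat" where
  "pauli 0 k = 1\<^sub>m 1"
| "pauli (Suc n) k = kron (pauli n (k div 4)) (pauli1 (k mod 4))"

definition superoperator :: "nat \<Rightarrow> superop \<Rightarrow> bool" where
  "superoperator n \<D> \<longleftrightarrow>
     (\<forall>A\<in>operators n. \<D> A \<in> operators n) \<and>
     (\<forall>A\<in>operators n. \<forall>B\<in>operators n. \<D> (A + B) = \<D> A + \<D> B) \<and>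
     (\<forall>c. \<forall>A\<in>operators n. \<D> (c \<cdot>\<^sub>m A) = c \<cdot>\<^sub>m \<D> A)"

definition hs_inner :: "complex mat \<Rightarrow> complex mat \<Rightarrow> complex" where
  "hs_inner A B = mat_trace (mat_adjoint A * B)"

definition hs_norm :: "complex mat \<Rightarrow> real" where
  "hs_norm A = sqrt (Re (hs_inner A A))"

definition self_adjoint_superop :: "nat \<Rightarrow> superop \<Rightarrow> bool" where
  "self_adjoint_superop n \<D> \<longleftrightarrow>
     (\<forall>A\<in>operators n. \<forall>B\<in>operators n. hs_inner A (\<D> B) = hs_inner (\<D> A) B)"

(* The matrix sum is written entrywise: matrices of unspecified size have no additive
   type class structure. *)
definition pauli_diagonal :: "nat \<Rightarrow> superop \<Rightarrow> bool" where
  "pauli_diagonal n \<D> \<longleftrightarrow>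
     (\<exists>f :: nat \<Rightarrow> complex. \<forall>A\<in>operators n.
        \<D> A = mat (2 ^ n) (2 ^ n)
          (\<lambda>ij. \<Sum>k<4 ^ n. (f k \<cdot>\<^sub>m (pauli n k * A * pauli n k)) $$ ij))"

(* Same shape as onorm; A = 0 contributes 0 / 0 = 0. The supremum is finite for linear maps
   because the operator space is finite-dimensional. *)
definition superop_norm :: "nat \<Rightarrow> superop \<Rightarrow> real" where
  "superop_norm n \<D> = (SUP A\<in>operators n. hs_norm (\<D> A) / hs_norm A)"

definition pauli_coeff :: "nat \<Rightarrow> complex mat \<Rightarrow> nat \<Rightarrow> complex" where
  "pauli_coeff n X k = mat_trace (pauli n k * X) / 2 ^ n"

definition pauli_vectorization :: "nat \<Rightarrow> complex mat \<Rightarrow> complex vec" where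
  "pauli_vectorization n X = vec (4 ^ n)
     (\<lambda>k. pauli_coeff n X k / complex_of_real (sqrt (\<Sum>i<4 ^ n. (cmod (pauli_coeff n X i))\<^sup>2)))"

definition superop_expectation :: "nat \<Rightarrow> superop \<Rightarrow> complex mat \<Rightarrow> complex" where
  "superop_expectation n \<D> X = hs_inner X (\<D> X) / 2 ^ n"

definition heisenberg :: "complex mat \<Rightarrow> complex mat \<Rightarrow> complex mat" where
  "heisenberg U Q = mat_adjoint U * Q * U"

(* Meaningful for unit vectors only; see pmf_computational_measurement. *)
definition computational_measurement :: "complex vec \<Rightarrow> nat pmf" where
  "computational_measurement v =
     embed_pmf (\<lambda>k. if k < dim_vec v then (cmod (v $ k))\<^sup>2 else 0)"

lemma pmf_computational_measurement:
  assumes "(\<Sum>k<dim_vec v. (cmod (v $ k))\<^sup>2) = 1"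
  shows "pmf (computational_measurement v) k = (if k < dim_vec v then (cmod (v $ k))\<^sup>2 else 0)"
  unfolding computational_measurement_def
proof (rule pmf_embed_pmf)
  let ?f = "\<lambda>k. if k < dim_vec v then (cmod (v $ k))\<^sup>2 else 0"
  have "(\<integral>\<^sup>+ k. ennreal (?f k) \<partial>count_space UNIV) = (\<Sum>k<dim_vec v. ennreal (?f k))"
    by (rule nn_integral_count_space') auto
  also have "\<dots> = ennreal (\<Sum>k<dim_vec v. ?f k)"
    by (rule sum_ennreal) auto
  also have "\<dots> = 1"
    using assms by simp
  finally show "(\<integral>\<^sup>+ k. ennreal (?f k) \<partial>count_space UNIV) = 1" .
qed auto

lemma pauli_vectorization_unit:
  assumes "k < 4 ^ n" "pauli_coeff n X k \<noteq> 0"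
  shows "(\<Sum>k<dim_vec (pauli_vectorization n X). (cmod (pauli_vectorization n X $ k))\<^sup>2) = 1"
proof -
  let ?s = "\<Sum>i<4 ^ n. (cmod (pauli_coeff n X i))\<^sup>2"
  have "0 < ?s"
    using assms by (intro sum_pos2[of _ k]) auto
  then show ?thesis
    by (simp add: pauli_vectorization_def norm_divide power_divide flip: sum_divide_distrib)
qed

end

theory Submission
  imports Defs
begin

text \<open>
  A superoperator that is diagonal in the Pauli basis has every Pauli string \<open>P\<^sub>k\<close> as an eigenvector,
  because \<open>P\<^sub>j P\<^sub>k P\<^sub>j = \<plusminus> P\<^sub>k\<close>; self-adjointness makes the eigenvalue \<open>g\<^sub>k\<close> real, and it is at most the
  norm in absolute value. By Parseval's identity for the Pauli basis, the expectation value is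
  \<open>\<Sum>\<^sub>k g\<^sub>k \<bar>c\<^sub>k\<bar>\<^sup>2\<close> with \<open>\<Sum>\<^sub>k \<bar>c\<^sub>k\<bar>\<^sup>2 = 1\<close>, which is the mean of \<open>g\<^sub>k\<close> when \<open>k\<close> is drawn by measuring the
  Pauli-basis vectorization. Hoeffding's inequality bounds the error of the empirical mean.
\<close>

section \<open>Pauli strings\<close>

lemma sum_div_mod:
  fixes F :: "nat \<Rightarrow> nat \<Rightarrow> 'a::comm_monoid_add"
  assumes "q > 0"
  shows "(\<Sum>k<m * q. F (k div q) (k mod q)) = (\<Sum>i<m. \<Sum>r<q. F i r)"
proof -
  have "(\<Sum>k<m * q. F (k div q) (k mod q))
      = (\<Sum>i<m. \<Sum>k\<in>{i * q..<i * q + q}. F (k div q) (k mod q))"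
    by (rule sum.nat_group[symmetric])
  also have "\<dots> = (\<Sum>i<m. \<Sum>r<q. F i r)"
  proof (rule sum.cong)
    fix i
    show "(\<Sum>k\<in>{i * q..<i * q + q}. F (k div q) (k mod q)) = (\<Sum>r<q. F i r)"
      using sum.shift_bounds_nat_ivl[of "\<lambda>k. F (k div q) (k mod q)" 0 "i * q" q] assms
      by (simp add: atLeast0LessThan add.commute)
  qed simp
  finally show ?thesis .
qed

text \<open>An index of a Kronecker product encodes a pair of factor indices as quotient and
  remainder, so a double sum of products of factor entries separates. With \<open>q = 2\<close> this
  splits off the last qubit in the inductions on \<open>n\<close>.\<close>

lemma double_sum_div_mod:
  fixes f g :: "nat \<Rightarrow> nat \<Rightarrow> 'a::comm_semiring_0"
  assumes "q > 0"
  shows "(\<Sum>i<m * q. \<Sum>j<m * q. f (i div q) (j div q) * g (i mod q) (j mod q))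
       = (\<Sum>i<m. \<Sum>j<m. f i j) * (\<Sum>s<q. \<Sum>t<q. g s t)"
proof -
  have "(\<Sum>i<m * q. \<Sum>j<m * q. f (i div q) (j div q) * g (i mod q) (j mod q))
      = (\<Sum>i<m. \<Sum>s<q. \<Sum>j<m. \<Sum>t<q. f i j * g s t)"
    using sum_div_mod[OF assms, of "\<lambda>i s. \<Sum>j<m * q. f i (j div q) * g s (j mod q)" m]
    by (simp only: sum_div_mod[OF assms, of "\<lambda>j t. f i j * g s t" m for i s])
  also have "\<dots> = (\<Sum>i<m. \<Sum>j<m. \<Sum>s<q. \<Sum>t<q. f i j * g s t)"
    by (intro sum.cong refl sum.swap)
  also have "\<dots> = (\<Sum>i<m. \<Sum>j<m. f i j) * (\<Sum>s<q. \<Sum>t<q. g s t)"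
    by (simp only: sum_distrib_left[symmetric] sum_distrib_right[symmetric])
  finally show ?thesis .
qed

section \<open>Adjoint, trace and Hilbert-Schmidt inner product in entries\<close>

lemma mat_adjoint_carrier: "A \<in> carrier_mat r c \<Longrightarrow> mat_adjoint A \<in> carrier_mat c r"
  by (auto simp: mat_adjoint_def)

lemma index_mat_adjoint:
  assumes "A \<in> carrier_mat r c" "i < c" "j < r"
  shows "mat_adjoint A $$ (i, j) = cnj (A $$ (j, i))"
  using assms by (auto simp: mat_adjoint_def mat_of_rows_def conjugate_complex_def)

lemma index_mult_mat_sum:
  assumes "A \<in> carrier_mat r N" "B \<in> carrier_mat N c" "i < r" "j < c"
  shows "(A * B) $$ (i, j) = (\<Sum>x<N. A $$ (i, x) * B $$ (x, j))"
  using assms by (auto simp: scalar_prod_def atLeast0LessThan intro!: sum.cong)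

lemma mat_trace_mult:
  assumes "A \<in> carrier_mat M N" "B \<in> carrier_mat N M"
  shows "mat_trace (A * B) = (\<Sum>i<M. \<Sum>j<N. A $$ (i, j) * B $$ (j, i))"
  using assms index_mult_mat_sum[OF assms] by (auto simp: mat_trace_def intro!: sum.cong)

lemma mat_trace_mult_commute:
  assumes "A \<in> carrier_mat M N" "B \<in> carrier_mat N M"
  shows "mat_trace (A * B) = mat_trace (B * A)"
  using assms by (subst (1 2) mat_trace_mult) (auto simp: mult.commute intro: sum.swap)

lemma hs_inner_entries:
  assumes "A \<in> carrier_mat M N" "B \<in> carrier_mat M N"
  shows "hs_inner A B = (\<Sum>i<M. \<Sum>j<N. cnj (A $$ (i, j)) * B $$ (i, j))"
  unfolding hs_inner_def
  by (subst mat_trace_mult[OF mat_adjoint_carrier[OF assms(1)] assms(2)], subst sum.swap)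
     (auto simp: index_mat_adjoint[OF assms(1)])

section \<open>Entries, completeness and norm of the Pauli strings\<close>

lemma pauli1_carrier: "pauli1 r \<in> carrier_mat 2 2"
  by (rule carrier_matI) (simp_all add: pauli1_def mat_of_rows_list_def)

text \<open>No bound on \<open>k\<close> is imposed here or in most later facts:
  \<open>pauli n k\<close> reads only the \<open>n\<close> lowest base-4 digits of \<open>k\<close>,
  so every \<open>k\<close> yields a Pauli string.\<close>

lemma pauli_carrier: "pauli n k \<in> operators n"
proof (induction n arbitrary: k)
  case (Suc n)
  show ?case
    using carrier_matD[OF Suc[of "k div 4"]] carrier_matD[OF pauli1_carrier[of "k mod 4"]]
    by (intro carrier_matI) (simp_all add: kron_def)
qed simp

lemma index_pauli_Suc:
  assumes "i < 2 ^ Suc n" "j < 2 ^ Suc n"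
  shows "pauli (Suc n) k $$ (i, j)
       = pauli n (k div 4) $$ (i div 2, j div 2) * pauli1 (k mod 4) $$ (i mod 2, j mod 2)"
  using assms pauli_carrier[of n "k div 4"] pauli1_carrier[of "k mod 4"]
  by (simp add: kron_def)

lemma index_pauli1:
  assumes "a < 2" "b < 2"
  shows "pauli1 r $$ (a, b) =
    (if r = 0 then if a = b then 1 else 0
     else if r = 1 then if a = b then 0 else 1
     else if r = 2 then if a = b then 0 else if a = 0 then - \<i> else \<i>
     else if a = b then if a = 0 then 1 else - 1 else 0)"
  using assms by (auto simp: pauli1_def mat_of_rows_list_def less_2_cases_iff)

lemma pauli_hermitian_entries:
  "i < 2 ^ n \<Longrightarrow> j < 2 ^ n \<Longrightarrow> cnj (pauli n k $$ (i, j)) = pauli n k $$ (j, i)"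
proof (induction n arbitrary: i j k)
  case (Suc n)
  have "cnj (pauli1 (k mod 4) $$ (i mod 2, j mod 2)) = pauli1 (k mod 4) $$ (j mod 2, i mod 2)"
    by (auto simp: index_pauli1)
  then show ?case
    using Suc.prems Suc.IH[of "i div 2" "j div 2" "k div 4"] by (simp add: index_pauli_Suc del: pauli.simps)
qed simp

lemma pauli_adjoint: "mat_adjoint (pauli n k) = pauli n k"
  by (rule eq_matI)
     (use pauli_carrier[of n k] mat_adjoint_carrier[OF pauli_carrier[of n k]] in
       \<open>auto simp: index_mat_adjoint[OF pauli_carrier] pauli_hermitian_entries\<close>)

lemma sum_lessThan_4: "(\<Sum>r<4. f r) = f 0 + f 1 + f 2 + f (3::nat)"
  by (simp add: eval_nat_numeral)

lemma sum_lessThan_2: "(\<Sum>r<2. f r) = f 0 + f (1::nat)"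
  by (simp add: eval_nat_numeral)

lemma pauli1_completeness:
  assumes "a < 2" "b < 2" "c < 2" "d < 2"
  shows "(\<Sum>r<4. cnj (pauli1 r $$ (a, b)) * pauli1 r $$ (c, d)) = (if a = c \<and> b = d then 2 else 0)"
  using assms by (auto simp: sum_lessThan_4 index_pauli1 less_2_cases_iff)

text \<open>The completeness relation of the Pauli basis, from which Parseval's identity follows.
  The lowest base-4 digit of \<open>k\<close> and the lowest bits of the matrix indices belong to
  the last tensor factor, so the sum over \<open>k\<close> is the sum for \<open>n\<close> qubits
  times the sum for one qubit.\<close>

lemma pauli_completeness:
  assumes "a < 2 ^ n" "b < 2 ^ n" "c < 2 ^ n" "d < 2 ^ n"
  shows "(\<Sum>k<4 ^ n. cnj (pauli n k $$ (a, b)) * pauli n k $$ (c, d))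
       = (if a = c \<and> b = d then 2 ^ n else 0)"
  using assms
proof (induction n arbitrary: a b c d)
  case (Suc n)
  let ?p = "\<lambda>k. cnj (pauli n k $$ (a div 2, b div 2)) * pauli n k $$ (c div 2, d div 2)"
  let ?q = "\<lambda>r. cnj (pauli1 r $$ (a mod 2, b mod 2)) * pauli1 r $$ (c mod 2, d mod 2)"
  have "(\<Sum>k<4 ^ Suc n. cnj (pauli (Suc n) k $$ (a, b)) * pauli (Suc n) k $$ (c, d))
      = (\<Sum>k<4 ^ n * 4. ?p (k div 4) * ?q (k mod 4))"
    using Suc.prems by (simp add: index_pauli_Suc mult_ac del: pauli.simps)
  also have "\<dots> = (\<Sum>k<4 ^ n. \<Sum>r<4. ?p k * ?q r)"
    by (rule sum_div_mod) simp
  also have "\<dots> = (\<Sum>k<4 ^ n. ?p k) * (\<Sum>r<4. ?q r)"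
    by (simp add: sum_product)
  also have "(\<Sum>k<4 ^ n. ?p k) = (if a div 2 = c div 2 \<and> b div 2 = d div 2 then 2 ^ n else 0)"
    using Suc.prems by (intro Suc.IH) auto
  also have "(\<Sum>r<4. ?q r) = (if a mod 2 = c mod 2 \<and> b mod 2 = d mod 2 then 2 else 0)"
    by (rule pauli1_completeness) auto
  finally have *: "(\<Sum>k<4 ^ Suc n. cnj (pauli (Suc n) k $$ (a, b)) * pauli (Suc n) k $$ (c, d))
      = (if a div 2 = c div 2 \<and> b div 2 = d div 2 then 2 ^ n else 0)
        * (if a mod 2 = c mod 2 \<and> b mod 2 = d mod 2 then 2 else 0)" .
  have "a = c \<longleftrightarrow> a div 2 = c div 2 \<and> a mod 2 = c mod 2"
       "b = d \<longleftrightarrow> b div 2 = d div 2 \<and> b mod 2 = d mod 2"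
    by (metis div_mult_mod_eq)+
  then show ?case
    unfolding * by auto
qed simp

text \<open>The squared Hilbert-Schmidt norm is multiplicative over Kronecker products, and it is 2
  for each single-qubit Pauli matrix.\<close>

lemma pauli_inner_self: "hs_inner (pauli n k) (pauli n k) = 2 ^ n"
proof -
  have "(\<Sum>i<2 ^ n. \<Sum>j<2 ^ n. cnj (pauli n k $$ (i, j)) * pauli n k $$ (i, j)) = 2 ^ n"
  proof (induction n arbitrary: k)
    case (Suc n)
    let ?p = "\<lambda>i j. cnj (pauli n (k div 4) $$ (i, j)) * pauli n (k div 4) $$ (i, j)"
    let ?q = "\<lambda>i j. cnj (pauli1 (k mod 4) $$ (i, j)) * pauli1 (k mod 4) $$ (i, j)"
    have "(\<Sum>i<2 ^ Suc n. \<Sum>j<2 ^ Suc n. cnj (pauli (Suc n) k $$ (i, j)) * pauli (Suc n) k $$ (i, j))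
        = (\<Sum>i<2 ^ n * 2. \<Sum>j<2 ^ n * 2. ?p (i div 2) (j div 2) * ?q (i mod 2) (j mod 2))"
      by (simp add: index_pauli_Suc mult_ac del: pauli.simps)
    also have "\<dots> = (\<Sum>i<2 ^ n. \<Sum>j<2 ^ n. ?p i j) * (\<Sum>s<2. \<Sum>t<2. ?q s t)"
      by (rule double_sum_div_mod) simp
    also have "(\<Sum>s<2. \<Sum>t<2. ?q s t) = 2"
      by (simp add: sum_lessThan_2 index_pauli1)
    finally show ?case
      unfolding Suc.IH by simp
  qed simp
  then show ?thesis
    by (simp add: hs_inner_entries[OF pauli_carrier pauli_carrier])
qed

section \<open>Conjugation of one Pauli string by another\<close>

lemma pauli1_conj_entries:
  "\<exists>s. \<forall>a<2. \<forall>b<2. (\<Sum>x<2. \<Sum>y<2. pauli1 k $$ (a, x) * pauli1 j $$ (x, y) * pauli1 k $$ (y, b))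
     = s * pauli1 j $$ (a, b)"
proof -
  \<comment> \<open>The sign is 1 exactly when the two matrices commute, that is, when one is the
    identity or both are equal. Since \<open>pauli1\<close> maps every index from 3 on to Z, all
    such indices count as equal.\<close>
  define s :: complex where "s = (if k = 0 \<or> j = 0 \<or> k = j \<or> 3 \<le> k \<and> 3 \<le> j then 1 else - 1)"
  have all_less_2: "(\<forall>a<2. Q a) \<longleftrightarrow> Q 0 \<and> Q 1" for Q :: "nat \<Rightarrow> bool"
    by (auto simp: less_2_cases_iff)
  consider "k = 0" | "k = 1" | "k = 2" | "3 \<le> k" by linarith
  moreover consider "j = 0" | "j = 1" | "j = 2" | "3 \<le> j" by linarith
  ultimately have "\<forall>a<2. \<forall>b<2.
     (\<Sum>x<2. \<Sum>y<2. pauli1 k $$ (a, x) * pauli1 j $$ (x, y) * pauli1 k $$ (y, b)) = s * pauli1 j $$ (a, b)"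
    unfolding s_def all_less_2 sum_lessThan_2 by cases (cases; simp add: index_pauli1)+
  then show ?thesis by blast
qed

text \<open>Conjugation acts on each tensor factor separately, so the scalars of the factors
  multiply. Writing the triple product as a double sum over entries lets
  \<open>double_sum_div_mod\<close> separate the last qubit.\<close>

lemma pauli_conj_entries:
  "\<exists>s. \<forall>a<2 ^ n. \<forall>b<2 ^ n.
     (\<Sum>x<2 ^ n. \<Sum>y<2 ^ n. pauli n k $$ (a, x) * pauli n j $$ (x, y) * pauli n k $$ (y, b))
     = s * pauli n j $$ (a, b)"
proof (induction n arbitrary: k j)
  case (Suc n)
  let ?P = "pauli n (k div 4)" and ?R = "pauli n (j div 4)"
  let ?p = "pauli1 (k mod 4)" and ?r = "pauli1 (j mod 4)"
  obtain s where s: "\<forall>a<2 ^ n. \<forall>b<2 ^ n.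
     (\<Sum>x<2 ^ n. \<Sum>y<2 ^ n. ?P $$ (a, x) * ?R $$ (x, y) * ?P $$ (y, b)) = s * ?R $$ (a, b)"
    using Suc.IH[of "k div 4" "j div 4"] by (rule exE)
  obtain s' where s': "\<forall>a<2. \<forall>b<2.
     (\<Sum>x<2. \<Sum>y<2. ?p $$ (a, x) * ?r $$ (x, y) * ?p $$ (y, b)) = s' * ?r $$ (a, b)"
    using pauli1_conj_entries[of "k mod 4" "j mod 4"] by (rule exE)
  have "(\<Sum>x<2 ^ Suc n. \<Sum>y<2 ^ Suc n.
      pauli (Suc n) k $$ (a, x) * pauli (Suc n) j $$ (x, y) * pauli (Suc n) k $$ (y, b))
      = s * s' * pauli (Suc n) j $$ (a, b)" if ab: "a < 2 ^ Suc n" "b < 2 ^ Suc n" for a b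
  proof -
    let ?F = "\<lambda>x y. ?P $$ (a div 2, x) * ?R $$ (x, y) * ?P $$ (y, b div 2)"
    let ?G = "\<lambda>x y. ?p $$ (a mod 2, x) * ?r $$ (x, y) * ?p $$ (y, b mod 2)"
    have "(\<Sum>x<2 ^ Suc n. \<Sum>y<2 ^ Suc n.
        pauli (Suc n) k $$ (a, x) * pauli (Suc n) j $$ (x, y) * pauli (Suc n) k $$ (y, b))
      = (\<Sum>x<2 ^ n * 2. \<Sum>y<2 ^ n * 2. ?F (x div 2) (y div 2) * ?G (x mod 2) (y mod 2))"
      using ab by (simp add: index_pauli_Suc mult_ac del: pauli.simps)
    also have "\<dots> = (\<Sum>x<2 ^ n. \<Sum>y<2 ^ n. ?F x y) * (\<Sum>u<2. \<Sum>v<2. ?G u v)"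
      by (rule double_sum_div_mod) simp
    also have "(\<Sum>x<2 ^ n. \<Sum>y<2 ^ n. ?F x y) = s * ?R $$ (a div 2, b div 2)"
      using ab by (intro s[rule_format]) auto
    also have "(\<Sum>u<2. \<Sum>v<2. ?G u v) = s' * ?r $$ (a mod 2, b mod 2)"
      by (intro s'[rule_format]) auto
    finally show ?thesis
      using ab by (simp add: index_pauli_Suc mult_ac del: pauli.simps)
  qed
  then show ?case
    by (intro exI[of _ "s * s'"]) blast
qed (auto intro: exI[of _ 1])

lemma pauli_conj: "\<exists>s. pauli n k * pauli n j * pauli n k = s \<cdot>\<^sub>m pauli n j"
proof -
  note c = pauli_carrier
  have c2: "pauli n k * pauli n j \<in> operators n"
    using c by (rule mult_carrier_mat) (rule c)
  obtain s where s: "\<forall>a<2 ^ n. \<forall>b<2 ^ n.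
     (\<Sum>x<2 ^ n. \<Sum>y<2 ^ n. pauli n k $$ (a, x) * pauli n j $$ (x, y) * pauli n k $$ (y, b))
     = s * pauli n j $$ (a, b)"
    using pauli_conj_entries[of n k j] by (rule exE)
  have "(pauli n k * pauli n j * pauli n k) $$ (a, b) = s * pauli n j $$ (a, b)"
    if "a < 2 ^ n" "b < 2 ^ n" for a b
  proof -
    have "(pauli n k * pauli n j * pauli n k) $$ (a, b)
       = (\<Sum>y<2 ^ n. \<Sum>x<2 ^ n. pauli n k $$ (a, x) * pauli n j $$ (x, y) * pauli n k $$ (y, b))"
      using that by (simp add: index_mult_mat_sum[OF c2 c] index_mult_mat_sum[OF c c] sum_distrib_right
        del: index_mult_mat)
    then show ?thesis
      by (subst (asm) sum.swap) (simp add: s that)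
  qed
  then show ?thesis
    using c[of n k] c[of n j] by (intro exI[of _ s] eq_matI) auto
qed

section \<open>Pauli-diagonal superoperators\<close>

lemma hs_inner_operators:
  assumes "A \<in> operators n" "B \<in> operators n"
  shows "hs_inner A B = (\<Sum>p\<in>{..<2 ^ n} \<times> {..<2 ^ n}. cnj (A $$ p) * B $$ p)"
  by (simp add: hs_inner_entries[OF assms] sum.cartesian_product case_prod_unfold)

lemma pauli_coeff_hs_inner: "pauli_coeff n X k = hs_inner (pauli n k) X / 2 ^ n"
  by (simp add: pauli_coeff_def hs_inner_def pauli_adjoint)

text \<open>Expanding both coefficients in entries gives a sum over \<open>k\<close> and two matrix
  positions; summing over \<open>k\<close> first, \<open>pauli_completeness\<close> leaves only
  equal positions. Each coefficient carries a factor \<open>1 / 2 ^ n\<close> and completeness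
  contributes \<open>2 ^ n\<close>, which accounts for the prefactor.\<close>

lemma hs_inner_pauli_coeff:
  assumes A: "A \<in> operators n" and B: "B \<in> operators n"
  shows "hs_inner A B = 2 ^ n * (\<Sum>k<4 ^ n. cnj (pauli_coeff n A k) * pauli_coeff n B k)"
proof -
  let ?S = "{..<2 ^ n} \<times> {..<2 ^ n} :: (nat \<times> nat) set" and ?P = "pauli n"
  have "(\<Sum>k<4 ^ n. cnj (hs_inner (?P k) A) * hs_inner (?P k) B)
      = (\<Sum>k<4 ^ n. \<Sum>p\<in>?S. \<Sum>q\<in>?S. cnj (A $$ p) * B $$ q * (cnj (?P k $$ q) * ?P k $$ p))"
    unfolding hs_inner_operators[OF pauli_carrier A] hs_inner_operators[OF pauli_carrier B]
      cnj_sum sum_product by (simp add: mult_ac)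
  also have "\<dots> = (\<Sum>p\<in>?S. \<Sum>k<4 ^ n. \<Sum>q\<in>?S. cnj (A $$ p) * B $$ q * (cnj (?P k $$ q) * ?P k $$ p))"
    by (rule sum.swap)
  also have "\<dots> = (\<Sum>p\<in>?S. \<Sum>q\<in>?S. cnj (A $$ p) * B $$ q * (\<Sum>k<4 ^ n. cnj (?P k $$ q) * ?P k $$ p))"
    unfolding sum_distrib_left by (intro sum.cong refl sum.swap)
  also have "\<dots> = (\<Sum>p\<in>?S. \<Sum>q\<in>?S. if p = q then cnj (A $$ p) * B $$ q * 2 ^ n else 0)"
  proof (intro sum.cong refl)
    fix p q assume "p \<in> ?S" "q \<in> ?S"
    then have "(\<Sum>k<4 ^ n. cnj (?P k $$ q) * ?P k $$ p) = (if p = q then 2 ^ n else 0)"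
      using pauli_completeness[of "fst q" n "snd q" "fst p" "snd p"] by (auto simp: prod_eq_iff)
    then show "cnj (A $$ p) * B $$ q * (\<Sum>k<4 ^ n. cnj (?P k $$ q) * ?P k $$ p)
        = (if p = q then cnj (A $$ p) * B $$ q * 2 ^ n else 0)"
      by simp
  qed
  also have "\<dots> = 2 ^ n * hs_inner A B"
    by (simp add: hs_inner_operators[OF A B] sum.delta' sum_distrib_left mult_ac)
  finally show ?thesis
    by (simp add: pauli_coeff_hs_inner field_simps flip: sum_divide_distrib)
qed

lemma hs_inner_self_pauli_coeff:
  assumes "A \<in> operators n"
  shows "hs_inner A A = complex_of_real (2 ^ n * (\<Sum>k<4 ^ n. (cmod (pauli_coeff n A k))\<^sup>2))"
  unfolding hs_inner_pauli_coeff[OF assms assms] of_real_mult of_real_sum complex_norm_square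
  by (simp add: mult.commute)

lemma hs_norm_pauli_coeff:
  assumes "A \<in> operators n"
  shows "hs_norm A = sqrt (2 ^ n * (\<Sum>k<4 ^ n. (cmod (pauli_coeff n A k))\<^sup>2))"
  unfolding hs_norm_def hs_inner_self_pauli_coeff[OF assms] by (simp only: Re_complex_of_real)

lemma hs_inner_smult_right:
  assumes "A \<in> carrier_mat M N" "B \<in> carrier_mat M N"
  shows "hs_inner A (c \<cdot>\<^sub>m B) = c * hs_inner A B"
proof -
  have "c \<cdot>\<^sub>m B \<in> carrier_mat M N"
    using assms by simp
  with assms show ?thesis
    by (simp add: hs_inner_entries[OF assms(1)] sum_distrib_left mult_ac)
qed

lemma hs_inner_smult_left:
  assumes "A \<in> carrier_mat M N" "B \<in> carrier_mat M N"
  shows "hs_inner (c \<cdot>\<^sub>m A) B = cnj c * hs_inner A B"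
proof -
  have "c \<cdot>\<^sub>m A \<in> carrier_mat M N"
    using assms by simp
  with assms show ?thesis
    by (simp add: hs_inner_entries[OF _ assms(2)] sum_distrib_left mult_ac)
qed

section \<open>Eigenvalues of a Pauli-diagonal superoperator\<close>

text \<open>By \<open>pauli_conj\<close> each term of \<D> only rescales the string, so the
  eigenvalue is the sum of the \<open>f k\<close> weighted by the conjugation scalars.\<close>

lemma pauli_diagonal_eigenvector:
  assumes "pauli_diagonal n \<D>"
  shows "\<exists>c. \<D> (pauli n j) = c \<cdot>\<^sub>m pauli n j"
proof -
  from assms obtain f where f: "\<And>A. A \<in> operators n \<Longrightarrow> \<D> A = mat (2 ^ n) (2 ^ n)
      (\<lambda>ij. \<Sum>k<4 ^ n. (f k \<cdot>\<^sub>m (pauli n k * A * pauli n k)) $$ ij)"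
    unfolding pauli_diagonal_def by auto
  obtain s where s: "\<And>k. pauli n k * pauli n j * pauli n k = s k \<cdot>\<^sub>m pauli n j"
    using pauli_conj[of n _ j] by metis
  have "\<D> (pauli n j) = (\<Sum>k<4 ^ n. f k * s k) \<cdot>\<^sub>m pauli n j"
    unfolding f[OF pauli_carrier] s
    using pauli_carrier[of n j] by (intro eq_matI) (auto simp: sum_distrib_left mult_ac)
  then show ?thesis ..
qed

text \<open>Self-adjointness tested on a Pauli string against itself equates the eigenvalue with its
  conjugate, since the string has nonzero norm.\<close>

lemma pauli_diagonal_real_eigenvalues:
  assumes "pauli_diagonal n \<D>" "self_adjoint_superop n \<D>"
  obtains g :: "nat \<Rightarrow> real" where "\<And>j. \<D> (pauli n j) = complex_of_real (g j) \<cdot>\<^sub>m pauli n j"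
proof -
  obtain c where c: "\<And>j. \<D> (pauli n j) = c j \<cdot>\<^sub>m pauli n j"
    using pauli_diagonal_eigenvector[OF assms(1)] by metis
  have "c j = cnj (c j)" for j
  proof -
    have "hs_inner (pauli n j) (\<D> (pauli n j)) = hs_inner (\<D> (pauli n j)) (pauli n j)"
      using assms(2) pauli_carrier unfolding self_adjoint_superop_def by blast
    then show ?thesis
      by (simp add: c hs_inner_smult_right[OF pauli_carrier pauli_carrier]
          hs_inner_smult_left[OF pauli_carrier pauli_carrier] pauli_inner_self)
  qed
  then have "c j = complex_of_real (Re (c j))" for j
    by (metis Reals_cnj_iff of_real_Re)
  with c show thesis
    by (intro that[of "\<lambda>j. Re (c j)"]) metis
qed

text \<open>Self-adjointness moves \<D> onto its eigenvector \<open>pauli n k\<close>, so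
  \<open>A\<close> need not be expanded in Pauli strings.\<close>

lemma pauli_coeff_superop:
  assumes "superoperator n \<D>" "self_adjoint_superop n \<D>" "A \<in> operators n"
    and g: "\<D> (pauli n k) = complex_of_real g \<cdot>\<^sub>m pauli n k"
  shows "pauli_coeff n (\<D> A) k = g * pauli_coeff n A k"
proof -
  have "hs_inner (pauli n k) (\<D> A) = hs_inner (\<D> (pauli n k)) A"
    using assms pauli_carrier unfolding self_adjoint_superop_def by blast
  then show ?thesis
    by (simp add: pauli_coeff_hs_inner g hs_inner_smult_left[OF pauli_carrier assms(3)])
qed

lemma superop_expectation_pauli_coeff:
  assumes "superoperator n \<D>" "self_adjoint_superop n \<D>" "X \<in> operators n"
    and g: "\<And>k. \<D> (pauli n k) = complex_of_real (g k) \<cdot>\<^sub>m pauli n k"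
  shows "superop_expectation n \<D> X = complex_of_real (\<Sum>k<4 ^ n. g k * (cmod (pauli_coeff n X k))\<^sup>2)"
proof -
  have "\<D> X \<in> operators n"
    using assms(1,3) by (simp add: superoperator_def)
  then show ?thesis
    by (simp add: superop_expectation_def hs_inner_pauli_coeff[OF assms(3)]
        pauli_coeff_superop[OF assms(1-3) g] complex_norm_square mult_ac del: of_real_power)
qed

text \<open>The quotient in the supremum takes the value \<open>\<bar>g j\<bar>\<close> at the
  eigenvector \<open>pauli n j\<close>.\<close>

lemma abs_eigenvalue_le_superop_norm:
  assumes D: "superoperator n \<D>" "self_adjoint_superop n \<D>"
    and g: "\<And>k. \<D> (pauli n k) = complex_of_real (g k) \<cdot>\<^sub>m pauli n k"
  shows "\<bar>g j\<bar> \<le> superop_norm n \<D>"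
proof -
  \<comment> \<open>A supremum of reals dominates its members only if the set is bounded above; this
    crude bound, at least every \<open>\<bar>g k\<bar>\<close> with \<open>k < 4 ^ n\<close>,
    suffices for that.\<close>
  define G where "G = (\<Sum>k<4 ^ n. \<bar>g k\<bar>)"
  have "G \<ge> 0"
    by (simp add: G_def sum_nonneg)
  have bound: "hs_norm (\<D> A) / hs_norm A \<le> G" if A: "A \<in> operators n" for A
  proof -
    have "\<D> A \<in> operators n"
      using D(1) A by (simp add: superoperator_def)
    then have "hs_norm (\<D> A) = sqrt (2 ^ n * (\<Sum>k<4 ^ n. (g k)\<^sup>2 * (cmod (pauli_coeff n A k))\<^sup>2))"
      by (simp add: hs_norm_pauli_coeff pauli_coeff_superop[OF D A g] norm_mult power_mult_distrib)
    also have "\<dots> \<le> sqrt (G\<^sup>2 * (2 ^ n * (\<Sum>k<4 ^ n. (cmod (pauli_coeff n A k))\<^sup>2)))"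
    proof -
      have "(g k)\<^sup>2 \<le> G\<^sup>2" if "k < 4 ^ n" for k
        using member_le_sum[of k "{..<4 ^ n}" "\<lambda>k. \<bar>g k\<bar>"] that \<open>G \<ge> 0\<close>
        by (simp add: G_def flip: abs_le_square_iff)
      then have "(\<Sum>k<4 ^ n. (g k)\<^sup>2 * (cmod (pauli_coeff n A k))\<^sup>2)
          \<le> (\<Sum>k<4 ^ n. G\<^sup>2 * (cmod (pauli_coeff n A k))\<^sup>2)"
        by (intro sum_mono mult_right_mono) auto
      then show ?thesis
        by (simp add: sum_distrib_left[symmetric])
    qed
    also have "\<dots> = G * hs_norm A"
      using \<open>G \<ge> 0\<close> by (simp add: hs_norm_pauli_coeff[OF A] real_sqrt_mult)
    finally have "hs_norm (\<D> A) \<le> G * hs_norm A" .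
    moreover have "hs_norm A \<ge> 0"
      by (simp add: hs_norm_pauli_coeff[OF A] sum_nonneg)
    \<comment> \<open>If \<open>hs_norm A = 0\<close>, the quotient is 0 by the convention for
      division by zero.\<close>
    ultimately show ?thesis
      using \<open>G \<ge> 0\<close> by (cases "hs_norm A = 0") (auto simp: divide_simps)
  qed
  have "hs_norm (pauli n j) > 0"
    by (simp add: hs_norm_def pauli_inner_self)
  moreover have "hs_norm (\<D> (pauli n j)) = \<bar>g j\<bar> * hs_norm (pauli n j)"
    by (simp add: g hs_norm_def hs_inner_smult_left[OF pauli_carrier] hs_inner_smult_right[OF pauli_carrier pauli_carrier]
        smult_carrier_mat pauli_carrier pauli_inner_self real_sqrt_mult)
  ultimately have "\<bar>g j\<bar> = hs_norm (\<D> (pauli n j)) / hs_norm (pauli n j)"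
    by simp
  also have "\<dots> \<le> superop_norm n \<D>"
    unfolding superop_norm_def
    by (rule cSUP_upper[OF pauli_carrier]) (auto intro!: bdd_aboveI[of _ G] bound)
  finally show ?thesis .
qed

section \<open>Heisenberg evolution preserves the normalization\<close>

lemma mat_adjoint_mult:
  fixes A B :: "complex mat"
  assumes A: "A \<in> carrier_mat L M" and B: "B \<in> carrier_mat M N"
  shows "mat_adjoint (A * B) = mat_adjoint B * mat_adjoint A"
proof (rule eq_matI)
  have AB: "A * B \<in> carrier_mat L N" using A B by simp
  note adj = mat_adjoint_carrier[OF A] mat_adjoint_carrier[OF B] mat_adjoint_carrier[OF AB]
  fix i j assume "i < dim_row (mat_adjoint B * mat_adjoint A)" "j < dim_col (mat_adjoint B * mat_adjoint A)"
  then have "i < N" "j < L" using adj by auto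
  then show "mat_adjoint (A * B) $$ (i, j) = (mat_adjoint B * mat_adjoint A) $$ (i, j)"
    by (simp add: index_mat_adjoint[OF AB] index_mult_mat_sum[OF A B] index_mult_mat_sum[OF adj(2,1)]
        index_mat_adjoint[OF A] index_mat_adjoint[OF B] mult.commute del: index_mult_mat)
qed (use A B mat_adjoint_carrier[OF A] mat_adjoint_carrier[OF B] mat_adjoint_carrier[of "A * B" L N] in auto)

lemma mat_adjoint_adjoint:
  fixes A :: "complex mat"
  assumes A: "A \<in> carrier_mat M N"
  shows "mat_adjoint (mat_adjoint A) = A"
  using A mat_adjoint_carrier[OF A] mat_adjoint_carrier[OF mat_adjoint_carrier[OF A]]
  by (intro eq_matI) (auto simp: index_mat_adjoint[OF mat_adjoint_carrier[OF A]] index_mat_adjoint[OF A])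

lemma heisenberg_carrier:
  assumes "Q \<in> operators n" "unitary_mat (2 ^ n) U"
  shows "heisenberg U Q \<in> operators n"
  using assms mat_adjoint_carrier[of U "2 ^ n" "2 ^ n"]
  by (auto simp: heisenberg_def unitary_mat_def)

text \<open>Hermiticity turns the inner product into the trace of the square of the evolved
  operator. One pair of unitaries cancels in the middle, the other after a cyclic shift under the
  trace.\<close>

lemma heisenberg_inner_self:
  assumes Q: "Q \<in> operators n" and "hermitian_mat Q" "mat_trace (Q * Q) = 2 ^ n"
    and U: "unitary_mat (2 ^ n) U"
  shows "hs_inner (heisenberg U Q) (heisenberg U Q) = 2 ^ n"
proof -
  let ?V = "mat_adjoint U"
  have Uc: "U \<in> operators n" and UV: "U * ?V = 1\<^sub>m (2 ^ n)"
    using U by (auto simp: unitary_mat_def)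
  have Vc: "?V \<in> operators n"
    using Uc by (rule mat_adjoint_carrier)
  have "mat_adjoint (?V * Q * U) = ?V * (mat_adjoint Q * mat_adjoint ?V)"
    using mat_adjoint_mult[of "?V * Q" "2 ^ n" "2 ^ n" U "2 ^ n"] mat_adjoint_mult[OF Vc Q] Uc Vc Q by simp
  also have "\<dots> = ?V * (Q * U)"
    using assms(2) mat_adjoint_adjoint[OF Uc] by (simp add: hermitian_mat_def)
  finally have "hs_inner (heisenberg U Q) (heisenberg U Q) = mat_trace ((?V * (Q * U)) * (?V * Q * U))"
    by (simp add: hs_inner_def heisenberg_def)
  also have "(?V * (Q * U)) * (?V * Q * U) = ?V * (Q * (U * ?V) * (Q * U))"
    using Uc Vc Q by (simp add: assoc_mult_mat[of _ "2 ^ n" "2 ^ n" _ "2 ^ n" _ "2 ^ n"])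
  also have "\<dots> = ?V * (Q * (Q * U))"
    using Q by (simp add: UV)
  also have "mat_trace \<dots> = mat_trace (Q * (Q * U) * ?V)"
    using Uc Vc Q by (intro mat_trace_mult_commute) auto
  also have "Q * (Q * U) * ?V = Q * Q * (U * ?V)"
    using Uc Vc Q by (simp add: assoc_mult_mat[of _ "2 ^ n" "2 ^ n" _ "2 ^ n" _ "2 ^ n"])
  also have "\<dots> = Q * Q"
    using Q by (simp add: UV)
  finally show ?thesis
    using assms(3) by simp
qed

section \<open>Hoeffding's inequality for independent samples\<close>

text \<open>Independence of the samples: the expectation of a product factorizes. With values in
  \<open>ennreal\<close> no integrability has to be checked.\<close>

lemma nn_integral_replicate_pmf_prod_list:
  fixes h :: "'a \<Rightarrow> ennreal"
  shows "(\<integral>\<^sup>+xs. prod_list (map h xs) \<partial>replicate_pmf m p) = (\<integral>\<^sup>+x. h x \<partial>p) ^ m"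
  by (induction m) (simp_all add: nn_integral_bind_pmf nn_integral_cmult nn_integral_multc)

text \<open>The Chernoff method: an exponential Markov bound, factored over the independent samples,
  with each factor bounded by Hoeffding's lemma.\<close>

lemma prob_replicate_pmf_Hoeffding_ge:
  fixes f :: "'a \<Rightarrow> real" and p :: "'a pmf"
  defines "\<mu> \<equiv> measure_pmf.expectation p f"
  assumes f: "\<And>x. x \<in> set_pmf p \<Longrightarrow> f x \<in> {a..b}" and "a < b" "m > 0" "\<epsilon> > 0"
  shows "measure_pmf.prob (replicate_pmf m p) {xs. sum_list (map (\<lambda>x. f x - \<mu>) xs) \<ge> \<epsilon>}
      \<le> exp (- 2 * \<epsilon>\<^sup>2 / (m * (b - a)\<^sup>2))"
proof -
  interpret interval_bounded_random_variable "measure_pmf p" f a b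
    by unfold_locales (use f in \<open>auto simp: AE_measure_pmf_iff\<close>)
  define d where "d = m * (b - a)\<^sup>2"
  \<comment> \<open>This \<open>l\<close> minimizes the exponent
    \<open>- l * \<epsilon> + l\<^sup>2 * d / 8\<close> obtained below; the minimum is
    \<open>- 2 * \<epsilon>\<^sup>2 / d\<close>.\<close>
  define l where "l = 4 * \<epsilon> / d"
  have "d > 0" "l > 0"
    using assms by (auto simp: d_def l_def)
  let ?S = "\<lambda>xs. sum_list (map (\<lambda>x. f x - \<mu>) xs)"
  let ?M = "replicate_pmf m p"
  have "ennreal (measure_pmf.prob ?M {xs. ?S xs \<ge> \<epsilon>}) = emeasure ?M {xs \<in> UNIV. ?S xs \<ge> \<epsilon>}"
    by (simp add: measure_pmf.emeasure_eq_measure)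
  also have "\<dots> \<le> ennreal (exp (- l * \<epsilon>)) * (\<integral>\<^sup>+xs\<in>UNIV. exp (l * ?S xs) \<partial>?M)"
    by (intro Chernoff_ineq_nn_integral_ge \<open>l > 0\<close>) auto
  also have "(\<integral>\<^sup>+xs\<in>UNIV. exp (l * ?S xs) \<partial>?M)
      = (\<integral>\<^sup>+xs. prod_list (map (\<lambda>x. ennreal (exp (l * (f x - \<mu>)))) xs) \<partial>?M)"
  proof (intro nn_integral_cong)
    fix xs :: "'a list"
    have "ennreal (exp (l * ?S xs)) = prod_list (map (\<lambda>x. ennreal (exp (l * (f x - \<mu>)))) xs)"
      by (induction xs) (simp_all add: ring_distribs exp_add ennreal_mult)
    then show "ennreal (exp (l * ?S xs)) * indicator UNIV xs
        = prod_list (map (\<lambda>x. ennreal (exp (l * (f x - \<mu>)))) xs)"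
      by simp
  qed
  also have "\<dots> = (\<integral>\<^sup>+x. ennreal (exp (l * (f x - \<mu>))) \<partial>p) ^ m"
    by (rule nn_integral_replicate_pmf_prod_list)
  also have "ennreal (exp (- l * \<epsilon>)) * \<dots> \<le> ennreal (exp (- l * \<epsilon>)) * ennreal (exp (l\<^sup>2 * (b - a)\<^sup>2 / 8)) ^ m"
    unfolding \<mu>_def using \<open>l > 0\<close>
    by (intro mult_left_mono power_mono Hoeffdings_lemma_nn_integral) auto
  also have "\<dots> = ennreal (exp (- l * \<epsilon> + m * (l\<^sup>2 * (b - a)\<^sup>2 / 8)))"
    by (simp only: exp_add exp_of_nat_mult) (simp add: ennreal_power flip: ennreal_mult)
  also have "- l * \<epsilon> + m * (l\<^sup>2 * (b - a)\<^sup>2 / 8) = - l * \<epsilon> + l\<^sup>2 * d / 8"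
    by (simp add: d_def)
  also have "\<dots> = - 2 * \<epsilon>\<^sup>2 / d"
    using \<open>d > 0\<close> by (simp add: l_def field_simps power2_eq_square)
  finally show ?thesis
    by (simp add: d_def)
qed

text \<open>The one-sided bound is applied to \<open>f\<close> and to \<open>- f\<close>, and a
  union bound gives the factor 2. The values lie in an interval of length \<open>2 * L\<close> and
  the sum deviates by \<open>m * \<epsilon>\<close>, which yields the exponent.\<close>

lemma prob_replicate_pmf_mean_ge:
  fixes f :: "'a \<Rightarrow> real" and p :: "'a pmf"
  assumes f: "\<And>x. x \<in> set_pmf p \<Longrightarrow> \<bar>f x\<bar> \<le> L" and "L > 0" "m > 0" "\<epsilon> > 0"
  shows "measure_pmf.prob (replicate_pmf m p)
      {xs. \<bar>sum_list (map f xs) / m - measure_pmf.expectation p f\<bar> \<le> \<epsilon>}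
      \<ge> 1 - 2 * exp (- (m * \<epsilon>\<^sup>2 / (2 * L\<^sup>2)))"
proof -
  define \<mu> where "\<mu> = measure_pmf.expectation p f"
  let ?M = "replicate_pmf m p"
  let ?E = "{xs. \<bar>sum_list (map f xs) / m - \<mu>\<bar> \<le> \<epsilon>}"
  let ?A = "{xs. sum_list (map (\<lambda>x. f x - \<mu>) xs) \<ge> m * \<epsilon>}"
  let ?B = "{xs. sum_list (map (\<lambda>x. \<mu> - f x) xs) \<ge> m * \<epsilon>}"
  have e: "- 2 * (m * \<epsilon>)\<^sup>2 / (m * (L - - L)\<^sup>2) = - (m * \<epsilon>\<^sup>2 / (2 * L\<^sup>2))"
    using assms by (simp add: field_simps power2_eq_square)
  have A: "measure_pmf.prob ?M ?A \<le> exp (- (m * \<epsilon>\<^sup>2 / (2 * L\<^sup>2)))"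
    unfolding \<mu>_def e[symmetric] using assms
    by (intro prob_replicate_pmf_Hoeffding_ge) (auto simp: abs_le_iff, force+)
  have "measure_pmf.prob ?M ?B \<le> exp (- (m * \<epsilon>\<^sup>2 / (2 * L\<^sup>2)))"
    using prob_replicate_pmf_Hoeffding_ge[of p "\<lambda>x. - f x" "- L" L m "m * \<epsilon>"] assms
    unfolding \<mu>_def e by (force simp: abs_le_iff)
  with A have "measure_pmf.prob ?M (?A \<union> ?B) \<le> 2 * exp (- (m * \<epsilon>\<^sup>2 / (2 * L\<^sup>2)))"
    using measure_Un_le[of ?A ?M ?B] by simp
  moreover have "measure_pmf.prob ?M (- ?E) \<le> measure_pmf.prob ?M (?A \<union> ?B)"
  proof (rule measure_pmf.finite_measure_mono_AE)
    \<comment> \<open>The length matters: the centred sums equal the plain sum shifted by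
      \<open>m * \<mu>\<close> because \<open>xs\<close> has \<open>m\<close> entries. Lists drawn
      from \<open>replicate_pmf m p\<close> have this length, so the inclusion of events holds
      almost everywhere.\<close>
    have "xs \<in> ?A \<union> ?B" if "length xs = m" "xs \<notin> ?E" for xs
    proof -
      have 1: "sum_list (map (\<lambda>x. f x - \<mu>) xs) = sum_list (map f xs) - m * \<mu>"
        "sum_list (map (\<lambda>x. \<mu> - f x) xs) = m * \<mu> - sum_list (map f xs)"
        unfolding that(1)[symmetric] by (induction xs) (simp_all add: algebra_simps)
      have "sum_list (map f xs) / m - \<mu> = (sum_list (map f xs) - m * \<mu>) / m"
        using \<open>m > 0\<close> by (simp add: field_simps)
      with that \<open>m > 0\<close> have "m * \<epsilon> \<le> \<bar>sum_list (map f xs) - m * \<mu>\<bar>"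
        by (simp add: abs_divide not_le field_simps)
      then show ?thesis
        by (auto simp: 1 abs_if split: if_splits)
    qed
    then show "AE xs in ?M. xs \<in> - ?E \<longrightarrow> xs \<in> ?A \<union> ?B"
      by (auto simp: AE_measure_pmf_iff set_replicate_pmf)
  qed auto
  moreover have "measure_pmf.prob ?M (- ?E) = 1 - measure_pmf.prob ?M ?E"
    using measure_pmf.prob_compl[of ?E ?M] by (simp add: Compl_eq_Diff_UNIV)
  ultimately show ?thesis
    unfolding \<mu>_def by linarith
qed

section \<open>Sampling in the Pauli basis\<close>

text \<open>By Parseval the squared moduli of the coefficients sum to 1, so the normalizing
  denominator of the vectorization is 1.\<close>

lemma pmf_pauli_measurement:
  assumes X: "X \<in> operators n" and "hs_inner X X = 2 ^ n"
  shows "pmf (computational_measurement (pauli_vectorization n X)) k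
       = (if k < 4 ^ n then (cmod (pauli_coeff n X k))\<^sup>2 else 0)"
proof -
  have "complex_of_real (2 ^ n * (\<Sum>k<4 ^ n. (cmod (pauli_coeff n X k))\<^sup>2)) = complex_of_real (2 ^ n)"
    using assms(2) by (simp only: hs_inner_self_pauli_coeff[OF X] of_real_power of_real_numeral)
  then have "(\<Sum>k<4 ^ n. (cmod (pauli_coeff n X k))\<^sup>2) = 1"
    unfolding of_real_eq_iff by simp
  then show ?thesis
    by (subst pmf_computational_measurement) (simp_all add: pauli_vectorization_def)
qed

text \<open>The estimator averages the eigenvalues \<open>g\<close> at the observed outcomes. It is
  computed from \<D> and the outcomes alone, and its mean is the expectation value, which is
  real.\<close>

lemma prob_pauli_sampling_mean_ge:
  assumes X: "X \<in> operators n" "hs_inner X X = 2 ^ n"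
    and D: "superoperator n \<D>" "self_adjoint_superop n \<D>"
    and g: "\<And>k. \<D> (pauli n k) = complex_of_real (g k) \<cdot>\<^sub>m pauli n k"
    and "superop_norm n \<D> > 0" "m > 0" "\<epsilon> > 0"
  shows "measure_pmf.prob
      (replicate_pmf m (computational_measurement (pauli_vectorization n X)))
      {ks. cmod (complex_of_real (sum_list (map g ks) / m) - superop_expectation n \<D> X) \<le> \<epsilon>}
      \<ge> 1 - 2 * exp (- (m * \<epsilon>\<^sup>2 / (2 * (superop_norm n \<D>)\<^sup>2)))"
proof -
  let ?p = "computational_measurement (pauli_vectorization n X)"
  have "measure_pmf.expectation ?p g = (\<Sum>k<4 ^ n. g k * pmf ?p k)"
    by (rule integral_measure_pmf_real)
       (auto simp: set_pmf_iff pmf_pauli_measurement[OF X] split: if_splits)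
  also have "complex_of_real \<dots> = superop_expectation n \<D> X"
    unfolding superop_expectation_pauli_coeff[OF D X(1) g] pmf_pauli_measurement[OF X]
    by (intro arg_cong[of _ _ complex_of_real] sum.cong) auto
  finally have "superop_expectation n \<D> X = complex_of_real (measure_pmf.expectation ?p g)"
    by simp
  then have "cmod (complex_of_real (sum_list (map g ks) / m) - superop_expectation n \<D> X)
      = \<bar>sum_list (map g ks) / m - measure_pmf.expectation ?p g\<bar>" for ks
    by (simp only: norm_of_real flip: of_real_diff)
  then show ?thesis
    using prob_replicate_pmf_mean_ge[of ?p g, OF abs_eigenvalue_le_superop_norm[OF D g]] assms(6-8)
    by simp
qed

text \<open>The expectation value is an average of eigenvalues with probability weights. This makes
  the constant estimate 0 good enough when the norm is below the target accuracy.\<close>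

lemma cmod_superop_expectation_le:
  assumes X: "X \<in> operators n" "hs_inner X X = 2 ^ n"
    and D: "superoperator n \<D>" "self_adjoint_superop n \<D>"
    and g: "\<And>k. \<D> (pauli n k) = complex_of_real (g k) \<cdot>\<^sub>m pauli n k"
  shows "cmod (superop_expectation n \<D> X) \<le> superop_norm n \<D>"
proof -
  let ?p = "pmf (computational_measurement (pauli_vectorization n X))"
  have "(\<Sum>k<4 ^ n. ?p k) = 1"
    by (intro sum_pmf_eq_1) (auto simp: set_pmf_iff pmf_pauli_measurement[OF X] split: if_splits)
  moreover have "cmod (superop_expectation n \<D> X) = \<bar>\<Sum>k<4 ^ n. g k * ?p k\<bar>"
    unfolding superop_expectation_pauli_coeff[OF D X(1) g] norm_of_real
    by (simp add: pmf_pauli_measurement[OF X])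
  moreover have "\<bar>\<Sum>k<4 ^ n. g k * ?p k\<bar> \<le> (\<Sum>k<4 ^ n. superop_norm n \<D> * ?p k)"
    by (intro order_trans[OF sum_abs] sum_mono)
       (simp add: abs_mult mult_right_mono abs_eigenvalue_le_superop_norm[OF D g])
  ultimately show ?thesis
    by (simp flip: sum_distrib_left)
qed

section \<open>Choice of the sample size\<close>

theorem corollary2:
  shows "\<exists>C\<^sub>0>0. \<forall>(n::nat) (\<D>::superop) (\<epsilon>::real) (\<delta>::real).
    n \<ge> 1 \<longrightarrow> superoperator n \<D> \<longrightarrow> self_adjoint_superop n \<D> \<longrightarrow> pauli_diagonal n \<D> \<longrightarrow>
    0 < \<epsilon> \<longrightarrow> \<epsilon> < 1 \<longrightarrow> 0 < \<delta> \<longrightarrow> \<delta> \<le> 1 / 2 \<longrightarrow>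
    (\<exists>(m::nat) (est :: nat list \<Rightarrow> real).
       real m \<le> C\<^sub>0 * (superop_norm n \<D>)\<^sup>2 * ln (1 / \<delta>) / \<epsilon>\<^sup>2 \<and>
       (\<forall>Q U. Q \<in> operators n \<longrightarrow> hermitian_mat Q \<longrightarrow> mat_trace (Q * Q) = 2 ^ n \<longrightarrow>
          unitary_mat (2 ^ n) U \<longrightarrow>
          measure_pmf.prob
            (replicate_pmf m (computational_measurement
              (pauli_vectorization n (heisenberg U Q))))
            {ks. cmod (complex_of_real (est ks)
                   - superop_expectation n \<D> (heisenberg U Q)) \<le> \<epsilon>} \<ge> 1 - \<delta>))"
\<comment> \<open>The constant is \<open>4 * 2\<close>: a factor 4 brings the failure probability
  down to \<delta>, and a factor 2 pays for rounding the sample size up to an integer.\<close>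
proof (rule exI[of _ 8], intro conjI allI impI)
  fix n :: nat and \<D> :: superop and \<epsilon> \<delta> :: real
  assume D: "superoperator n \<D>" "self_adjoint_superop n \<D>" and diag: "pauli_diagonal n \<D>"
    and \<epsilon>: "0 < \<epsilon>" and \<delta>: "0 < \<delta>" "\<delta> \<le> 1 / 2"
  obtain g where g: "\<And>k. \<D> (pauli n k) = complex_of_real (g k) \<cdot>\<^sub>m pauli n k"
    using pauli_diagonal_real_eigenvalues[OF diag D(2)] by blast
  define L where "L = superop_norm n \<D>"
  \<comment> \<open>The condition \<delta> \<le> 1/2 keeps the logarithm away from 0. This is what
    later gives \<open>1 \<le> x\<close> and lets \<open>ln 2\<close> be absorbed.\<close>
  have "ln (1 / \<delta>) \<ge> ln 2"
    using \<delta> by (simp add: field_simps)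
  with ln2_ge_two_thirds have ln_ge: "ln (1 / \<delta>) \<ge> 1 / 2"
    by linarith
  \<comment> \<open>Evolved observables enter only as normalized operators \<open>X\<close>. Both
    \<open>m\<close> and \<open>est\<close> are fixed before \<open>X\<close>, so neither can depend
    on the observable or the unitary.\<close>
  have "\<exists>(m::nat) est. real m \<le> 8 * L\<^sup>2 * ln (1 / \<delta>) / \<epsilon>\<^sup>2 \<and>
    (\<forall>X\<in>operators n. hs_inner X X = 2 ^ n \<longrightarrow>
       measure_pmf.prob (replicate_pmf m (computational_measurement (pauli_vectorization n X)))
         {ks. cmod (complex_of_real (est ks) - superop_expectation n \<D> X) \<le> \<epsilon>} \<ge> 1 - \<delta>)"
  proof (cases "L < \<epsilon>")
    \<comment> \<open>Here the bound on the number of samples may be below 1, so none can be drawn.\<close>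
    case True
    then have "cmod (superop_expectation n \<D> X) \<le> \<epsilon>"
      if "X \<in> operators n" "hs_inner X X = 2 ^ n" for X
      using cmod_superop_expectation_le[OF that D g] by (simp add: L_def)
    then show ?thesis
      using \<delta> ln_ge by (intro exI[of _ 0] exI[of _ "\<lambda>_. 0"]) auto
  next
    case False
    define x where "x = 4 * L\<^sup>2 * ln (1 / \<delta>) / \<epsilon>\<^sup>2"
    define m where "m = nat \<lceil>x\<rceil>"
    have "1 * (1 / 2) \<le> L\<^sup>2 / \<epsilon>\<^sup>2 * ln (1 / \<delta>)"
      using False \<epsilon> ln_ge by (intro mult_mono) (simp_all add: power_mono)
    then have "1 \<le> x"
      by (simp add: x_def)
    \<comment> \<open>Rounding up adds less than 1, which is at most \<open>x\<close>.\<close>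
    then have m: "x \<le> m" "m \<le> 2 * x" "m > 0"
      by (auto simp: m_def) linarith
    \<comment> \<open>The 2 inside the logarithm compensates the factor 2 of the two-sided Hoeffding
      bound; the resulting \<open>2 * ln (1 / \<delta>)\<close> is exactly what the factor 4 in
      \<open>x\<close> provides.\<close>
    have "ln (2 / \<delta>) \<le> 2 * ln (1 / \<delta>)"
      using \<open>ln (1 / \<delta>) \<ge> ln 2\<close> \<delta> by (simp add: ln_div)
    also have "\<dots> = x * \<epsilon>\<^sup>2 / (2 * L\<^sup>2)"
      using False \<epsilon> by (simp add: x_def)
    also have "\<dots> \<le> m * \<epsilon>\<^sup>2 / (2 * L\<^sup>2)"
      using m(1) by (intro divide_right_mono mult_right_mono) auto
    finally have "2 * exp (- (m * \<epsilon>\<^sup>2 / (2 * L\<^sup>2))) \<le> 2 * exp (- ln (2 / \<delta>))"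
      by simp
    also have "\<dots> = \<delta>"
      using \<delta> by (simp add: exp_minus)
    finally have "1 - \<delta> \<le> 1 - 2 * exp (- (m * \<epsilon>\<^sup>2 / (2 * L\<^sup>2)))"
      by simp
    then have "measure_pmf.prob (replicate_pmf m (computational_measurement (pauli_vectorization n X)))
         {ks. cmod (complex_of_real (sum_list (map g ks) / m) - superop_expectation n \<D> X) \<le> \<epsilon>} \<ge> 1 - \<delta>"
      if "X \<in> operators n" "hs_inner X X = 2 ^ n" for X
      unfolding L_def using False \<epsilon> m(3)
      by (rule_tac order_trans[OF _ prob_pauli_sampling_mean_ge[OF that D g]]) (simp_all add: L_def)
    moreover have "m \<le> 8 * L\<^sup>2 * ln (1 / \<delta>) / \<epsilon>\<^sup>2"
      using m(2) by (simp add: x_def)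
    ultimately show ?thesis
      by (intro exI[of _ m] exI[of _ "\<lambda>ks. sum_list (map g ks) / m"]) blast
  qed
  then show "\<exists>(m::nat) (est :: nat list \<Rightarrow> real).
       real m \<le> 8 * (superop_norm n \<D>)\<^sup>2 * ln (1 / \<delta>) / \<epsilon>\<^sup>2 \<and>
       (\<forall>Q U. Q \<in> operators n \<longrightarrow> hermitian_mat Q \<longrightarrow> mat_trace (Q * Q) = 2 ^ n \<longrightarrow>
          unitary_mat (2 ^ n) U \<longrightarrow>
          measure_pmf.prob
            (replicate_pmf m (computational_measurement
              (pauli_vectorization n (heisenberg U Q))))
            {ks. cmod (complex_of_real (est ks)
                   - superop_expectation n \<D> (heisenberg U Q)) \<le> \<epsilon>} \<ge> 1 - \<delta>)"
    unfolding L_def by (metis heisenberg_carrier heisenberg_inner_self)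
qed simp

end
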